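(* For every odd integer $d\ge 3$ and every prime power $q\ge d+2$, $$M(q+1,q-d)\ \ge\ \mathcal{T}_d(q).$$
   Context: For permutations $\pi,\sigma$ of the same $n$ symbols, the Hamming distance $hd(\pi,\sigma)$ is the number of positions $x$ with $\pi(x)\ne\sigma(x)$. $M(n,D)$ is the maximum size of a set of permutations on $n$ symbols in which any two distinct permutations have Hamming distance at least $D$. Let $q$ be a prime power, $\mathbb{F}_q$ the field with $q$ elements and $\mathcal{P}^1(\mathbb{F}_q)=\mathbb{F}_q\cup\{\infty\}$. Let $V,U$ be nonzero polynomials over $\mathbb{F}_q$ with $\gcd(V,U)=1$, of degrees $v,u$ and leading coefficients $a_v,b_u$. The rational function $V(x)/U(x)$ is evaluated on $\mathcal{P}^1(\mathbb{F}_q)$ as follows: at $a\in\mathbb{F}_q$ its value is $V(a)/U(a)$, understood as $\infty$ if $U(a)=0$; at $\infty$ its value is $\infty$ if $v>u$, $0$ if $v<u$, and $a_v/b_v$ if $v=u$. It is a permutation rational function (PRF) if it permutes $\mathcal{P}^1(\mathbb{F}_q)$. $P_{v,u}(q)$ is the set of PRFs $V(x)/U(x)$ (as rational functions, so $V/U$ and $(cV)/(cU)$ with $c\in\mathbb{F}_q\setminus\{0\}$ are the same element) with $\deg V=v$ and $\deg U=u$, and $N_{v,u}(q)=|P_{v,u}(q)|$. For odd $d$, $\mathcal{T}_d(q)=\sum N_{v,u}(q)$, the sum being over all pairs $(v,u)$ with $0\le v,u\le (d+1)/2$. *)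

theory Defs
  imports
    "HOL-Computational_Algebra.Polynomial"
    "HOL-Computational_Algebra.Fraction_Field"
    "HOL-Combinatorics.Permutations"
    "HOL-Number_Theory.Prime_Powers"
begin

text \<open>The \<open>n\<close> symbols are taken to be the elements of \<open>{..<n}\<close>.\<close>

definition hamming_dist :: "nat \<Rightarrow> (nat \<Rightarrow> nat) \<Rightarrow> (nat \<Rightarrow> nat) \<Rightarrow> nat" where
  "hamming_dist n \<pi> \<sigma> = card {x \<in> {..<n}. \<pi> x \<noteq> \<sigma> x}"

definition perm_array :: "nat \<Rightarrow> nat \<Rightarrow> (nat \<Rightarrow> nat) set \<Rightarrow> bool" where
  "perm_array n D A \<longleftrightarrow>
     (\<forall>\<pi>\<in>A. \<pi> permutes {..<n}) \<and>
     (\<forall>\<pi>\<in>A. \<forall>\<sigma>\<in>A. \<pi> \<noteq> \<sigma> \<longrightarrow> D \<le> hamming_dist n \<pi> \<sigma>)"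

text \<open>
  The maximum is over a finite set, since there are finitely many permutations of \<open>{..<n}\<close>,
  and over a nonempty one, since the empty set is always an admissible array.
\<close>

definition max_perm_array :: "nat \<Rightarrow> nat \<Rightarrow> nat" where
  "max_perm_array n D = Max {card A | A. perm_array n D A}"

text \<open>
  The projective line over the field \<open>'a\<close> is \<open>'a option\<close>: \<open>None\<close> is the point at infinity
  and \<open>Some a\<close> is the affine point \<open>a\<close>. The definition below is meant for nonzero coprime
  \<open>V\<close>, \<open>U\<close>.
\<close>

definition rat_eval :: "'a::field poly \<Rightarrow> 'a poly \<Rightarrow> 'a option \<Rightarrow> 'a option" where
  "rat_eval V U x =
     (case x of
        Some a \<Rightarrow> if poly U a = 0 then None else Some (poly V a / poly U a)
      | None \<Rightarrow>
          if degree V > degree U then None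
          else if degree V < degree U then Some 0
          else Some (lead_coeff V / lead_coeff U))"

text \<open>
  Elements of \<open>PRFs v u\<close> live in the fraction field of the polynomial ring, so that \<open>V/U\<close> and
  \<open>(cV)/(cU)\<close> are counted once.
\<close>

definition PRFs :: "nat \<Rightarrow> nat \<Rightarrow> 'a::field poly fract set" where
  "PRFs v u = {Fract V U | V U.
     V \<noteq> 0 \<and> U \<noteq> 0 \<and> coprime V U \<and> degree V = v \<and> degree U = u \<and> bij (rat_eval V U)}"

definition num_PRFs :: "'a::{field,finite} itself \<Rightarrow> nat \<Rightarrow> nat \<Rightarrow> nat" where
  "num_PRFs _ v u = card (PRFs v u :: 'a poly fract set)"

definition total_PRFs :: "'a::{field,finite} itself \<Rightarrow> nat \<Rightarrow> nat" where
  "total_PRFs F d = (\<Sum>v\<in>{0..(d + 1) div 2}. \<Sum>u\<in>{0..(d + 1) div 2}. num_PRFs F v u)"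

end

theory Submission
  imports Defs
begin

text \<open>
  Two distinct rational functions \<open>V/U\<close> and \<open>R/S\<close> whose numerators and denominators have degree
  at most \<open>m = (d + 1) div 2\<close> agree at a finite point only if it is a root of the nonzero
  polynomial \<open>V S - R U\<close>, of degree at most \<open>2 m = d + 1\<close>. If they also agree at infinity, the
  coefficient of degree \<open>2 m\<close> cancels and there are at most \<open>d\<close> such roots. In either case there
  are at most \<open>d + 1\<close> agreements on the \<open>q + 1\<close> points of the projective line. As \<open>d + 1 < q + 1\<close>,
  distinct functions also induce distinct permutations.
\<close>

section \<open>Divisibility of polynomials and reduced fractions\<close>

lemma bezout_field_poly:
  fixes p q :: "'a::field poly"
  shows "\<exists>x y. x * p + y * q dvd p \<and> x * p + y * q dvd q"
proof (induction "euclidean_size q" arbitrary: p q rule: less_induct)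
  case less
  show ?case
  proof (cases "q = 0")
    case True
    then have "1 * p + 0 * q dvd p \<and> 1 * p + 0 * q dvd q" by simp
    then show ?thesis by blast
  next
    case False
    then have "euclidean_size (p mod q) < euclidean_size q"
      by (rule mod_size_less)
    from less[OF this, of q] obtain x y
      where xy: "x * q + y * (p mod q) dvd q" "x * q + y * (p mod q) dvd p mod q"
      by blast
    from xy have "x * q + y * (p mod q) dvd p"
      by (simp add: dvd_mod_iff)
    \<comment> \<open>Euclid's algorithm: substituting \<open>p mod q = p - (p div q) * q\<close>
      turns the combination for \<open>(q, p mod q)\<close> into one for
      \<open>(p, q)\<close>.\<close>
    moreover have "x * q + y * (p mod q) = y * p + (x - y * (p div q)) * q"
      by (simp add: minus_div_mult_eq_mod[symmetric] algebra_simps)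
    ultimately show ?thesis using xy(1) by metis
  qed
qed

text \<open>Coprimality makes the Bezout combination of \<open>p\<close> and \<open>q\<close> a
  unit, and \<open>p\<close> divides \<open>r\<close> times that combination.\<close>

lemma coprime_dvd_mult_field_poly:
  fixes p q r :: "'a::field poly"
  assumes "coprime p q" "p dvd r * q"
  shows "p dvd r"
proof -
  obtain x y where g: "x * p + y * q dvd p" "x * p + y * q dvd q"
    using bezout_field_poly by blast
  have "is_unit (x * p + y * q)"
    using coprime_common_divisor[OF assms(1) g] .
  moreover have "p dvd r * (x * p + y * q)"
  proof -
    have "r * (x * p + y * q) = p * (r * x) + (r * q) * y"
      by (simp add: algebra_simps)
    then show ?thesis using assms(2) by simp
  qed
  ultimately show ?thesis
    using dvd_mult_unit_iff by blast
qed

text \<open>In \<open>V * S = R * U\<close> coprimality forces \<open>V\<close> and \<open>R\<close>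
  to divide each other. So the degrees in lowest terms belong to the fraction itself, and no
  fraction is counted under two degree pairs.\<close>

lemma Fract_eq_degree:
  fixes V U R S :: "'a::field poly"
  assumes "Fract V U = Fract R S" "coprime V U" "coprime R S"
    and "V \<noteq> 0" "U \<noteq> 0" "R \<noteq> 0" "S \<noteq> 0"
  shows "degree V = degree R" "degree U = degree S"
proof -
  have eq: "V * S = R * U"
    using assms by (simp add: eq_fract)
  have "V dvd R"
    by (rule coprime_dvd_mult_field_poly[OF assms(2)]) (simp flip: eq)
  moreover have "R dvd V"
    by (rule coprime_dvd_mult_field_poly[OF assms(3)]) (simp add: eq)
  ultimately show VR: "degree V = degree R"
    using assms by (intro antisym dvd_imp_degree_le)
  have "degree V + degree S = degree R + degree U"
    using arg_cong[OF eq, of degree] assms by (simp add: degree_mult_eq)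
  with VR show "degree U = degree S" by simp
qed

section \<open>Agreement of two rational functions on the projective line\<close>

lemma coeff_mult_degree_bound:
  assumes "degree p \<le> m" "degree q \<le> n"
  shows "coeff (p * q) (m + n) = coeff p m * coeff q n"
proof -
  have "coeff (p * q) (m + n) = (\<Sum>i\<le>m + n. coeff p i * coeff q (m + n - i))"
    by (rule coeff_mult)
  also have "\<dots> = (\<Sum>i\<in>{m}. coeff p i * coeff q (m + n - i))"
  proof (rule sum.mono_neutral_right)
    show "\<forall>i\<in>{..m + n} - {m}. coeff p i * coeff q (m + n - i) = 0"
    proof
      fix i assume "i \<in> {..m + n} - {m}"
      then have "m < i \<or> n < m + n - i" by auto
      then show "coeff p i * coeff q (m + n - i) = 0"
        using assms by (auto simp: coeff_eq_0)
    qed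
  qed auto
  finally show ?thesis by simp
qed

text \<open>A finite common value gives the root by cross-multiplication; at a common pole
  \<open>U\<close> and \<open>S\<close> both vanish, hence so do both products.\<close>

lemma rat_eval_Some_eq_imp_root:
  assumes "rat_eval V U (Some a) = rat_eval R S (Some a)"
  shows "poly (V * S - R * U) a = 0"
  using assms by (auto simp: rat_eval_def field_simps split: if_splits)

lemma rat_eval_None_eq_imp_coeff:
  assumes "rat_eval V U None = rat_eval R S None"
    and "V \<noteq> 0" "U \<noteq> 0" "R \<noteq> 0" "S \<noteq> 0"
    and "degree V \<le> m" "degree U \<le> m" "degree R \<le> m" "degree S \<le> m"
  shows "coeff V m * coeff S m = coeff R m * coeff U m"
proof -
  \<comment> \<open>The shared value is infinity, zero or a ratio of leading coefficients. Such a
    ratio is nonzero, so the last two kinds of value cannot coincide.\<close>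
  consider (inf) "degree U < degree V" "degree S < degree R"
    | (zero) "degree V < degree U" "degree R < degree S"
    | (fin) "degree V = degree U" "degree R = degree S"
        "lead_coeff V / lead_coeff U = lead_coeff R / lead_coeff S"
    using assms(1-5)
    by (auto simp: rat_eval_def split: if_splits) (metis leading_coeff_0_iff)+
  then show ?thesis
  proof cases
    case inf
    then show ?thesis using assms by (simp add: coeff_eq_0)
  next
    case zero
    then show ?thesis using assms by (simp add: coeff_eq_0)
  next
    case fin
    show ?thesis
    proof (cases "degree V = m \<and> degree R = m")
      case True
      have "lead_coeff U \<noteq> 0" "lead_coeff S \<noteq> 0"
        using assms by simp_all
      from fin(3)[unfolded frac_eq_eq[OF this]] True fin(1,2) show ?thesis by simp
    next
      case False
      \<comment> \<open>One of the two fractions has both its degrees below \<open>m\<close>. Each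
        side of the goal has a factor from each fraction, so both sides vanish.\<close>
      with fin assms have "degree V < m \<and> degree U < m \<or> degree R < m \<and> degree S < m"
        by auto
      then show ?thesis by (auto simp: coeff_eq_0)
    qed
  qed
qed

lemma card_rat_eval_agree_le:
  fixes V U R S :: "'a::{field,finite} poly"
  assumes "Fract V U \<noteq> Fract R S"
    and nz: "V \<noteq> 0" "U \<noteq> 0" "R \<noteq> 0" "S \<noteq> 0"
    and deg: "degree V \<le> m" "degree U \<le> m" "degree R \<le> m" "degree S \<le> m"
  shows "card {x. rat_eval V U x = rat_eval R S x} \<le> 2 * m"
proof -
  define P where "P = V * S - R * U"
  have "P \<noteq> 0"
    using assms by (simp add: P_def eq_fract)
  have "degree (V * S) \<le> 2 * m" "degree (R * U) \<le> 2 * m"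
    using degree_mult_le[of V S] degree_mult_le[of R U] deg by linarith+
  then have degP: "degree P \<le> 2 * m"
    unfolding P_def by (rule degree_diff_le)
  let ?A = "{x. rat_eval V U x = rat_eval R S x}"
  let ?Z = "{a. poly P a = 0}"
  have finite_part: "?A - {None} \<subseteq> Some ` ?Z"
  proof
    fix x assume "x \<in> ?A - {None}"
    then obtain a where "x = Some a" "rat_eval V U (Some a) = rat_eval R S (Some a)"
      by auto
    then show "x \<in> Some ` ?Z"
      using rat_eval_Some_eq_imp_root unfolding P_def by blast
  qed
  have "card (?A - {None}) \<le> card (Some ` ?Z)"
    by (rule card_mono[OF _ finite_part]) simp
  also have "\<dots> = card ?Z"
    by (simp add: card_image)
  also have "\<dots> \<le> degree P"
    by (rule card_poly_roots_bound[OF \<open>P \<noteq> 0\<close>])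
  finally have roots: "card (?A - {None}) \<le> degree P" .
  show ?thesis
  proof (cases "None \<in> ?A")
    case False
    with roots degP show ?thesis by simp
  next
    case True
    then have "coeff V m * coeff S m = coeff R m * coeff U m"
      using rat_eval_None_eq_imp_coeff[OF _ nz deg] by simp
    then have "coeff P (m + m) = 0"
      by (simp add: P_def coeff_mult_degree_bound deg)
    then have "degree P \<noteq> 2 * m"
      using \<open>P \<noteq> 0\<close> by (metis leading_coeff_0_iff mult_2)
    with degP have "degree P < 2 * m" by simp
    moreover have "card ?A = Suc (card (?A - {None}))"
      using True by (intro card.remove) simp_all
    ultimately show ?thesis using roots by simp
  qed
qed

section \<open>From bijections of a finite type to permutation arrays\<close>

lemma perm_array_card_le_max:
  assumes "perm_array n D A"
  shows "card A \<le> max_perm_array n D"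
proof -
  have "{card A | A. perm_array n D A} \<subseteq> card ` Pow {\<pi>. \<pi> permutes {..<n}}"
    by (auto simp: perm_array_def)
  then have "finite {card A | A. perm_array n D A}"
    by (rule finite_subset) (simp add: finite_permutations)
  then show ?thesis
    unfolding max_perm_array_def using assms by (auto intro!: Max_ge)
qed

text \<open>Conjugation by a numbering \<open>h\<close> of the points is injective on self-maps and
  preserves the number of disagreements, so the family becomes a permutation array of the same
  size.\<close>

lemma bij_family_card_le_max_perm_array:
  fixes A :: "('b::finite \<Rightarrow> 'b) set"
  assumes n: "card (UNIV :: 'b set) = n"
    and bij: "\<And>f. f \<in> A \<Longrightarrow> bij f"
    and dist: "\<And>f g. f \<in> A \<Longrightarrow> g \<in> A \<Longrightarrow> f \<noteq> g \<Longrightarrow> D \<le> card {x. f x \<noteq> g x}"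
  shows "card A \<le> max_perm_array n D"
proof -
  obtain h :: "'b \<Rightarrow> nat" where "bij_betw h UNIV {0..<n}"
    using ex_bij_betw_finite_nat[of "UNIV :: 'b set"] n by auto
  then have h: "bij_betw h UNIV {..<n}"
    by (simp add: lessThan_atLeast0)
  define k where "k = inv_into UNIV h"
  have k: "bij_betw k {..<n} UNIV"
    unfolding k_def by (rule bij_betw_inv_into[OF h])
  have kh: "k (h x) = x" for x
    unfolding k_def by (rule bij_betw_inv_into_left[OF h]) simp
  have hn: "h x < n" for x
    using h by (auto simp: bij_betw_def)
  have inj_h: "h x = h y \<longleftrightarrow> x = y" for x y
    using kh by metis
  \<comment> \<open>Outside \<open>{..<n}\<close> the map is the identity, as
    \<open>permutes\<close> demands.\<close>
  define T where "T f x = (if x < n then h (f (k x)) else x)" for f x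
  have T_h: "T f (h x) = h (f x)" for f x
    by (simp add: T_def hn kh)
  have perm: "T f permutes {..<n}" if "bij f" for f
  proof (rule bij_imp_permutes)
    have "bij_betw (h \<circ> f \<circ> k) {..<n} {..<n}"
      using k that h by (intro bij_betw_trans)
    then show "bij_betw (T f) {..<n} {..<n}"
      by (rule bij_betw_cong[THEN iffD1, rotated]) (simp add: T_def)
  qed (simp add: T_def)
  have "inj T"
  proof (rule injI, rule ext)
    fix f g x assume "T f = T g"
    then show "f x = g x"
      using T_h inj_h by metis
  qed
  have ham: "hamming_dist n (T f) (T g) = card {x. f x \<noteq> g x}" for f g
  proof -
    have "{x \<in> {..<n}. T f x \<noteq> T g x} = h ` {x. f x \<noteq> g x}"
    proof -
      have "{..<n} = range h"
        using h by (simp add: bij_betw_def)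
      then show ?thesis by (auto simp: T_h inj_h)
    qed
    then show ?thesis
      unfolding hamming_dist_def
      by (simp add: card_image inj_on_def inj_h)
  qed
  have "perm_array n D (T ` A)"
    unfolding perm_array_def using perm bij dist ham by auto
  then have "card (T ` A) \<le> max_perm_array n D"
    by (rule perm_array_card_le_max)
  moreover have "card (T ` A) = card A"
    by (rule card_image[OF inj_on_subset[OF \<open>inj T\<close>]]) simp
  ultimately show ?thesis by simp
qed

section \<open>Counting the permutation rational functions\<close>

lemma PRFs_disjoint:
  assumes "f \<in> PRFs v u" "f \<in> PRFs v' u'"
  shows "v = v' \<and> u = u'"
  using assms unfolding PRFs_def by (auto dest: Fract_eq_degree)

theorem theorem3p4:
  fixes d q :: nat
  assumes "odd d" and "d \<ge> 3"
    and "primepow q" and "q \<ge> d + 2"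
    and "card (UNIV :: 'a::{field,finite} set) = q"
  shows "max_perm_array (q + 1) (q - d) \<ge> total_PRFs TYPE('a) d"
proof -
  define m where "m = (d + 1) div 2"
  have m: "2 * m = d + 1"
    using assms(1) by (auto simp: m_def)
  define I where "I = {0..m} \<times> {0..m}"
  define P :: "'a poly fract set" where "P = (\<Union>i\<in>I. PRFs (fst i) (snd i))"
  have "\<exists>V U. f = Fract V U \<and> V \<noteq> 0 \<and> U \<noteq> 0 \<and> degree V \<le> m \<and> degree U \<le> m
      \<and> bij (rat_eval V U)" if "f \<in> P" for f
    using that unfolding P_def I_def PRFs_def by fastforce
  \<comment> \<open>\<open>rat_eval\<close> takes a pair of polynomials, so one representing pair is
    chosen for each fraction.\<close>
  then obtain V U where VU: "\<And>f. f \<in> P \<Longrightarrow> f = Fract (V f) (U f) \<and> V f \<noteq> 0 \<and> U f \<noteq> 0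
      \<and> degree (V f) \<le> m \<and> degree (U f) \<le> m \<and> bij (rat_eval (V f) (U f))"
    by metis
  define E where "E f = rat_eval (V f) (U f)" for f
  have card_line: "card (UNIV :: 'a option set) = q + 1"
    using assms(5) by (simp add: UNIV_option_conv card_image)
  have dist: "q - d \<le> card {x. E f x \<noteq> E g x}" if "f \<in> P" "g \<in> P" "f \<noteq> g" for f g
  proof -
    have "card {x. E f x = E g x} \<le> 2 * m"
      unfolding E_def using VU[OF that(1)] VU[OF that(2)] that(3)
      by (intro card_rat_eval_agree_le) auto
    moreover have "{x. E f x \<noteq> E g x} = UNIV - {x. E f x = E g x}"
      by auto
    then have "card {x. E f x \<noteq> E g x} = q + 1 - card {x. E f x = E g x}"
      by (simp add: card_Diff_subset card_line)
    \<comment> \<open>At least \<open>q + 1 - 2 * m = q + 1 - (d + 1)\<close> points remain.\<close>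
    ultimately show ?thesis using m by simp
  qed
  have inj: "inj_on E P"
  proof (rule inj_onI, rule ccontr)
    fix f g assume fg: "f \<in> P" "g \<in> P" "E f = E g" "f \<noteq> g"
    then show False
      \<comment> \<open>Equal maps disagree nowhere, while \<open>q - d\<close> is at least
        2.\<close>
      using dist[of f g] assms(4) by simp
  qed
  \<comment> \<open>Fractions of polynomials form an infinite type; \<open>P\<close> is finite
    because \<open>E\<close> embeds it into the self-maps of a finite set.\<close>
  have "finite (E ` P)" by simp
  then have finP: "finite P"
    using inj by (rule finite_imageD)
  have "total_PRFs TYPE('a) d = (\<Sum>i\<in>I. card (PRFs (fst i) (snd i) :: 'a poly fract set))"
    unfolding total_PRFs_def num_PRFs_def I_def m_def
    by (simp add: sum.cartesian_product case_prod_beta)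
  also have "\<dots> = card P"
    unfolding P_def
  proof (subst card_UN_disjoint)
    show "\<forall>i\<in>I. finite (PRFs (fst i) (snd i) :: 'a poly fract set)"
      using finite_subset[OF _ finP] unfolding P_def by blast
    show "\<forall>i\<in>I. \<forall>j\<in>I. i \<noteq> j \<longrightarrow>
        (PRFs (fst i) (snd i) :: 'a poly fract set) \<inter> PRFs (fst j) (snd j) = {}"
      using PRFs_disjoint by (metis disjoint_iff prod_eqI)
  qed (simp_all add: I_def)
  also have "\<dots> = card (E ` P)"
    by (simp add: card_image inj)
  also have "\<dots> \<le> max_perm_array (q + 1) (q - d)"
  proof (rule bij_family_card_le_max_perm_array[OF card_line])
    show "bij e" if "e \<in> E ` P" for e
      using that VU by (auto simp: E_def)
    show "q - d \<le> card {x. e x \<noteq> e' x}" if "e \<in> E ` P" "e' \<in> E ` P" "e \<noteq> e'" for e e'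
      using that dist by auto
  qed
  finally show ?thesis .
qed

end
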